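(* Let $A\subseteq[0,\infty)$ have at least two elements. If $\sup A>5\inf A$, then in a residual set of $\Omega$ there is no more than one geodesic ray in $\mathbb{Z}^d$; that is, there is a residual set $R\subseteq\Omega$ such that for every configuration $\omega\in R$ there do not exist two distinct geodesic rays in $\mathbb{Z}^d$.
   Context: Let $E$ be the set of nearest neighbor edges of the lattice $\mathbb{Z}^d$ (edges join lattice points at $\ell_1$-distance $1$). The set $A$ may be unbounded, in which case $\sup A=\infty$. The space of configurations is $\Omega=\prod_{e\in E}A$, where $A$ carries the subspace topology inherited from $\mathbb{R}$ and $\Omega$ the product topology. A subset of $\Omega$ is residual if its complement is meager, i.e. a countable union of nowhere dense sets. For a configuration $\omega=(\tau(e))_{e\in E}\in\Omega$, $\tau(e)$ is the passage time of the edge $e$; for a finite path $\Gamma$ of consecutive edges, $\tau(\Gamma)=\sum_{e\in\Gamma}\tau(e)$. For lattice points $x,y$, $T(x,y)=\inf_\Gamma\tau(\Gamma)$, the infimum being over all finite paths $\Gamma$ connecting $x$ to $y$. A geodesic between $x$ and $y$ is a finite path $\Gamma$ connecting $x$ to $y$ with $\tau(\Gamma)=T(x,y)$. A geodesic ray is a self-avoiding path of infinitely many edges indexed by $\mathbb{N}$ (infinite in one direction only, with a starting vertex) each of whose finite subpaths is a geodesic between its endpoints. Two geodesic rays are called distinct if they share only finitely many edges.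
   Formalization: The dimension is assumed to satisfy d ≥ 2; for d = 1 the claim fails (e.g. A = {0,1}), since the left and right half-lines from 0 are always two distinct geodesic rays. *)

theory Defs
  imports "HOL-Analysis.Analysis"
begin

section \<open>Baire category\<close>

definition nowhere_dense_in :: "'a topology \<Rightarrow> 'a set \<Rightarrow> bool" where
  "nowhere_dense_in X S \<longleftrightarrow> S \<subseteq> topspace X \<and> X interior_of (X closure_of S) = {}"

definition meager_in :: "'a topology \<Rightarrow> 'a set \<Rightarrow> bool" where
  "meager_in X S \<longleftrightarrow> (\<exists>\<N>. countable \<N> \<and> (\<forall>N\<in>\<N>. nowhere_dense_in X N) \<and> S = \<Union>\<N>)"

definition residual_in :: "'a topology \<Rightarrow> 'a set \<Rightarrow> bool" where
  "residual_in X R \<longleftrightarrow> R \<subseteq> topspace X \<and> meager_in X (topspace X - R)"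

section \<open>First passage percolation on the integer lattice\<close>

text \<open>
  The lattice is \<^typ>\<open>int ^ 'd\<close>, of dimension \<open>CARD('d)\<close>. An (undirected) edge is the set of
  its two endpoints.
\<close>

definition lattice_edges :: "(int ^ 'd) set set" where
  "lattice_edges = {{u, v} | u v. (\<Sum>i\<in>UNIV. \<bar>u $ i - v $ i\<bar>) = 1}"

text \<open>
  The points of the product topology are extensional: a configuration takes the value
  \<^const>\<open>undefined\<close> on sets of lattice points that are not edges.
\<close>

definition config_space :: "real set \<Rightarrow> ((int ^ 'd) set \<Rightarrow> real) topology" where
  "config_space A = product_topology (\<lambda>_. top_of_set A) lattice_edges"

text \<open>
  A finite path is given by the list of the vertices it visits. It may revisit vertices and edges,
  the passage time then being counted with multiplicity; the one-vertex path has no edges and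
  passage time 0.
\<close>

definition path_between :: "int ^ 'd \<Rightarrow> int ^ 'd \<Rightarrow> (int ^ 'd) list \<Rightarrow> bool" where
  "path_between x y p \<longleftrightarrow>
     p \<noteq> [] \<and> hd p = x \<and> last p = y \<and> successively (\<lambda>u v. {u, v} \<in> lattice_edges) p"

definition path_time :: "((int ^ 'd) set \<Rightarrow> real) \<Rightarrow> (int ^ 'd) list \<Rightarrow> real" where
  "path_time \<omega> p = sum_list (map2 (\<lambda>u v. \<omega> {u, v}) p (tl p))"

definition passage_time :: "((int ^ 'd) set \<Rightarrow> real) \<Rightarrow> int ^ 'd \<Rightarrow> int ^ 'd \<Rightarrow> real" where
  "passage_time \<omega> x y = (INF p\<in>{p. path_between x y p}. path_time \<omega> p)"

definition geodesic :: "((int ^ 'd) set \<Rightarrow> real) \<Rightarrow> int ^ 'd \<Rightarrow> int ^ 'd \<Rightarrow> (int ^ 'd) list \<Rightarrow> bool" where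
  "geodesic \<omega> x y p \<longleftrightarrow> path_between x y p \<and> path_time \<omega> p = passage_time \<omega> x y"

definition geodesic_ray :: "((int ^ 'd) set \<Rightarrow> real) \<Rightarrow> (nat \<Rightarrow> int ^ 'd) \<Rightarrow> bool" where
  "geodesic_ray \<omega> \<gamma> \<longleftrightarrow>
     inj \<gamma> \<and> (\<forall>n. {\<gamma> n, \<gamma> (Suc n)} \<in> lattice_edges) \<and>
     (\<forall>m n. m \<le> n \<longrightarrow> geodesic \<omega> (\<gamma> m) (\<gamma> n) (map \<gamma> [m..<Suc n]))"

definition ray_edges :: "(nat \<Rightarrow> int ^ 'd) \<Rightarrow> (int ^ 'd) set set" where
  "ray_edges \<gamma> = range (\<lambda>n. {\<gamma> n, \<gamma> (Suc n)})"

definition distinct_rays :: "(nat \<Rightarrow> int ^ 'd) \<Rightarrow> (nat \<Rightarrow> int ^ 'd) \<Rightarrow> bool" where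
  "distinct_rays \<gamma> \<delta> \<longleftrightarrow> finite (ray_edges \<gamma> \<inter> ray_edges \<delta>)"

end

(* For almost every configuration in the sense of category, each finite cube is surrounded by a
   trap: a much larger cube in which all further edges are slow, except those of a straight highway
   to its boundary and those on the boundary itself. Going out along the highway and around the
   boundary takes at most 5 times as many edges as going straight, so every geodesic ray starting
   in the inner cube leaves through the last edge of the highway. Any two geodesic rays therefore
   share edges outside every finite cube. *)

theory Submission
  imports Defs
begin

text \<open>The inner cube absorbs whatever is prescribed in advance: a basic open set of the
  product topology restricts finitely many edges, so all edges outside some \<open>cube n\<close>
  are free to form a trap. A trap in turn puts finitely many edges into open sets of values, so it
  is an open condition. The obstacle is that the values inside the inner cube cannot be controlled.
  They are therefore only bounded by some \<open>M\<close>, chosen after \<open>n\<close>, and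
  \<open>N\<close> is chosen last, so large that the gain of \<open>\<beta> - 5 * \<alpha>\<close>
  per unit of distance pays for crossing the inner cube to the foot of the highway.\<close>

section \<open>Lattice geometry: the l1 metric, cubes, rectangles, highways\<close>

definition l1_dist :: "int ^ 'd \<Rightarrow> int ^ 'd \<Rightarrow> int" where
  "l1_dist u v = (\<Sum>i\<in>UNIV. \<bar>u $ i - v $ i\<bar>)"

definition cube :: "int \<Rightarrow> (int ^ 'd) set" where
  "cube n = {x. \<forall>i. \<bar>x $ i\<bar> \<le> n}"

definition cube_boundary :: "int \<Rightarrow> (int ^ 'd) set" where
  "cube_boundary n = {x \<in> cube n. \<exists>i. \<bar>x $ i\<bar> = n}"

text \<open>This is the interval of the l1 metric: the points on shortest lattice paths from
  \<open>u\<close> to \<open>v\<close>.\<close>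

definition rect :: "int ^ 'd \<Rightarrow> int ^ 'd \<Rightarrow> (int ^ 'd) set" where
  "rect u v = {x. \<forall>i. min (u $ i) (v $ i) \<le> x $ i \<and> x $ i \<le> max (u $ i) (v $ i)}"

definition highway :: "'d::finite \<Rightarrow> int \<Rightarrow> int \<Rightarrow> (int ^ 'd) set" where
  "highway a n N = axis a ` {n..N}"

text \<open>Upper bounds on passage times are carried by explicit paths, so they add up under
  concatenation; the infimum enters only in \<open>geodesic_time_le\<close>.\<close>

definition reachable :: "((int ^ 'd) set \<Rightarrow> real) \<Rightarrow> int ^ 'd \<Rightarrow> int ^ 'd \<Rightarrow> real \<Rightarrow> bool" where
  "reachable \<omega> u v c \<longleftrightarrow> (\<exists>p. path_between u v p \<and> path_time \<omega> p \<le> c)"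

lemma l1_dist_nonneg: "0 \<le> l1_dist u v"
  by (simp add: l1_dist_def sum_nonneg)

lemma l1_dist_commute: "l1_dist u v = l1_dist v u"
  by (simp add: l1_dist_def abs_minus_commute)

lemma l1_dist_triangle: "l1_dist u w \<le> l1_dist u v + l1_dist v w"
  unfolding l1_dist_def sum.distrib[symmetric] by (rule sum_mono) linarith

lemma l1_dist_eq_0_iff: "l1_dist u v = 0 \<longleftrightarrow> u = v"
  by (simp add: l1_dist_def sum_nonneg_eq_0_iff vec_eq_iff)

lemma component_le_l1_dist: "\<bar>u $ i - v $ i\<bar> \<le> l1_dist u v"
  unfolding l1_dist_def by (rule member_le_sum) auto

lemma edge_iff: "{u, v} \<in> lattice_edges \<longleftrightarrow> l1_dist u v = 1"
proof
  assume "{u, v} \<in> lattice_edges"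
  then obtain x y where "{u, v} = {x, y}" "l1_dist x y = 1"
    by (auto simp: lattice_edges_def l1_dist_def)
  then show "l1_dist u v = 1"
    by (metis doubleton_eq_iff l1_dist_commute)
qed (auto simp: lattice_edges_def l1_dist_def)

lemma edge_cases:
  assumes "e \<in> lattice_edges"
  obtains u v where "e = {u, v}" "l1_dist u v = 1"
  using assms by (auto simp: lattice_edges_def l1_dist_def)

section \<open>Passage times of finite paths and their upper bounds\<close>

lemma path_time_Cons [simp]: "path_time \<omega> (u # v # p) = \<omega> {u, v} + path_time \<omega> (v # p)"
  by (simp add: path_time_def)

lemma path_time_singleton [simp]: "path_time \<omega> [u] = 0"
  by (simp add: path_time_def)

lemma path_time_snoc:
  "p \<noteq> [] \<Longrightarrow> path_time \<omega> (p @ [v]) = path_time \<omega> p + \<omega> {last p, v}"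
  by (induction p rule: induct_list012) auto

lemma path_time_nonneg:
  assumes "\<And>e. e \<in> lattice_edges \<Longrightarrow> 0 \<le> \<omega> e"
    and "successively (\<lambda>u v. {u, v} \<in> lattice_edges) p"
  shows "0 \<le> path_time \<omega> p"
  using assms(2)
proof (induction p rule: induct_list012)
  case 1
  then show ?case by (simp add: path_time_def)
qed (use assms(1) in auto)

lemma path_time_map:
  assumes "m \<le> n"
  shows "path_time \<omega> (map \<gamma> [m..<Suc n]) = (\<Sum>j=m..<n. \<omega> {\<gamma> j, \<gamma> (Suc j)})"
  using assms
proof (induction rule: dec_induct)
  case (step n)
  have "path_time \<omega> (map \<gamma> [m..<Suc (Suc n)]) = path_time \<omega> (map \<gamma> [m..<Suc n] @ [\<gamma> (Suc n)])"
    using step.hyps by simp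
  also have "\<dots> = path_time \<omega> (map \<gamma> [m..<Suc n]) + \<omega> {\<gamma> n, \<gamma> (Suc n)}"
    using step.hyps by (subst path_time_snoc) auto
  finally show ?case
    using step by simp
qed auto

lemma reachable_refl: "reachable \<omega> u u 0"
  unfolding reachable_def by (rule exI[of _ "[u]"]) (simp add: path_between_def)

lemma reachable_mono: "reachable \<omega> u v c \<Longrightarrow> c \<le> c' \<Longrightarrow> reachable \<omega> u v c'"
  unfolding reachable_def by (meson order_trans)

lemma reachable_step:
  assumes "{u, v} \<in> lattice_edges" "reachable \<omega> v w c"
  shows "reachable \<omega> u w (\<omega> {u, v} + c)"
proof -
  obtain p where p: "path_between v w p" "path_time \<omega> p \<le> c"
    using assms(2) by (auto simp: reachable_def)
  then obtain q where "p = v # q"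
    by (cases p) (auto simp: path_between_def)
  with p assms(1) have "path_between u w (u # p)" "path_time \<omega> (u # p) \<le> \<omega> {u, v} + c"
    by (auto simp: path_between_def)
  then show ?thesis
    by (auto simp: reachable_def)
qed

lemma path_reachable:
  "path_between u v p \<Longrightarrow> reachable \<omega> v w c \<Longrightarrow> reachable \<omega> u w (path_time \<omega> p + c)"
proof (induction p arbitrary: u rule: induct_list012)
  case (3 x y zs)
  then have "path_between y v (y # zs)" "{u, y} \<in> lattice_edges" "u = x"
    by (auto simp: path_between_def)
  with 3 reachable_step[of u y \<omega> w "path_time \<omega> (y # zs) + c"] show ?case
    by (simp add: add.assoc)
qed (auto simp: path_between_def)

lemma reachable_trans:
  "reachable \<omega> u v c \<Longrightarrow> reachable \<omega> v w c' \<Longrightarrow> reachable \<omega> u w (c + c')"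
  by (metis add.commute add_le_cancel_left path_reachable reachable_def reachable_mono)

text \<open>Induction on the distance: a unit step towards \<open>v\<close> in a coordinate in which
  the points differ lowers it by one, and the rectangle of the new pair is nested in the old one, so
  the edge bound is inherited.\<close>

lemma reachable_rect:
  assumes "\<And>x y. x \<in> rect u v \<Longrightarrow> y \<in> rect u v \<Longrightarrow> l1_dist x y = 1 \<Longrightarrow> \<omega> {x, y} \<le> c"
  shows "reachable \<omega> u v (c * l1_dist u v)"
  using assms
proof (induction "nat (l1_dist u v)" arbitrary: u)
  case 0
  then have "u = v"
    using l1_dist_eq_0_iff[of u v] l1_dist_nonneg[of u v] by linarith
  then show ?case
    using reachable_refl[of \<omega> v] l1_dist_eq_0_iff[of v v] by simp
next
  case (Suc k)
  then have "u \<noteq> v"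
    using l1_dist_eq_0_iff[of u v] by auto
  then obtain i where i: "u $ i \<noteq> v $ i"
    by (auto simp: vec_eq_iff)
  define u' where "u' = (\<chi> j. if j = i then u $ i + sgn (v $ i - u $ i) else u $ j)"
  have *: "(\<Sum>j\<in>UNIV. f j) = f i + (\<Sum>j\<in>UNIV-{i}. f j)" for f :: "'a \<Rightarrow> int"
    by (simp add: sum.remove)
  have d1: "l1_dist u u' = 1"
    unfolding l1_dist_def * u'_def using i by (simp add: sgn_if)
  have d2: "l1_dist u v = 1 + l1_dist u' v"
    unfolding l1_dist_def * u'_def using i by (simp add: sgn_if)
  have sub: "rect u' v \<subseteq> rect u v"
  proof
    fix x assume x: "x \<in> rect u' v"
    have "min (u $ j) (v $ j) \<le> x $ j \<and> x $ j \<le> max (u $ j) (v $ j)" for j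
      using x[unfolded rect_def u'_def mem_Collect_eq, rule_format, of j] i
      by (auto simp: sgn_if split: if_splits)
    then show "x \<in> rect u v" by (simp add: rect_def)
  qed
  have "u \<in> rect u v" "u' \<in> rect u' v"
    by (simp_all add: rect_def)
  then have "\<omega> {u, u'} \<le> c"
    using Suc.prems d1 sub by blast
  moreover have "reachable \<omega> u' v (c * l1_dist u' v)"
    using Suc d2 sub by (intro Suc.hyps) auto
  then have "reachable \<omega> u v (\<omega> {u, u'} + c * l1_dist u' v)"
    using d1 by (intro reachable_step) (auto simp: edge_iff)
  ultimately show ?case
    by (elim reachable_mono) (simp add: d2 algebra_simps)
qed

text \<open>A real infimum is a lower bound only if the set is bounded below; nonnegative edge
  values provide the bound 0.\<close>

lemma geodesic_time_le:
  assumes "\<And>e. e \<in> lattice_edges \<Longrightarrow> 0 \<le> \<omega> e" "geodesic \<omega> x y p" "reachable \<omega> x y c"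
  shows "path_time \<omega> p \<le> c"
proof -
  obtain q where q: "path_between x y q" "path_time \<omega> q \<le> c"
    using assms(3) by (auto simp: reachable_def)
  have "passage_time \<omega> x y \<le> path_time \<omega> q"
    unfolding passage_time_def
  proof (rule cINF_lower)
    show "bdd_below (path_time \<omega> ` {p. path_between x y p})"
      using path_time_nonneg[OF assms(1)] by (intro bdd_belowI[of _ 0]) (auto simp: path_between_def)
  qed (use q in auto)
  with q assms(2) show ?thesis by (simp add: geodesic_def)
qed

section \<open>Cubes and their faces\<close>

lemma cube_mono: "n \<le> m \<Longrightarrow> cube n \<subseteq> cube m"
  by (auto simp: cube_def intro: order_trans)

lemma finite_cube: "finite (cube n :: (int ^ 'd::finite) set)"
proof -
  have "(cube n :: (int ^ 'd) set) \<subseteq> vec_lambda ` (PiE UNIV (\<lambda>_. {-n..n}))"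
  proof
    fix x :: "int ^ 'd" assume "x \<in> cube n"
    then have "vec_nth x \<in> PiE UNIV (\<lambda>_. {-n..n})"
      by (auto simp: cube_def abs_le_iff minus_le_iff)
    then show "x \<in> vec_lambda ` (PiE UNIV (\<lambda>_. {-n..n}))"
      by (metis image_eqI vec_nth_inverse)
  qed
  then show ?thesis
    by (rule finite_subset) (simp add: finite_PiE)
qed

lemma finite_subset_cube:
  assumes "finite (S :: (int ^ 'd::finite) set)"
  shows "\<exists>n\<ge>m. S \<subseteq> cube n"
  using assms
proof (induction S)
  case (insert x S)
  then obtain n where n: "n \<ge> m" "S \<subseteq> cube n" by blast
  define k where "k = max n (l1_dist x 0)"
  have "x \<in> cube k"
    using component_le_l1_dist[of x _ 0] by (auto simp: cube_def k_def intro: max.coboundedI2)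
  moreover have "S \<subseteq> cube k"
    using n cube_mono[of n k] by (auto simp: k_def)
  ultimately show ?case
    using n by (intro exI[of _ k]) (auto simp: k_def)
qed auto

lemma l1_dist_cube:
  fixes u v :: "int ^ 'd::finite"
  assumes "u \<in> cube n" "v \<in> cube n"
  shows "l1_dist u v \<le> 2 * int CARD('d) * n"
proof -
  have "l1_dist u v \<le> (\<Sum>i\<in>(UNIV :: 'd set). 2 * n)"
    unfolding l1_dist_def
  proof (rule sum_mono)
    fix i
    show "\<bar>u $ i - v $ i\<bar> \<le> 2 * n"
      using assms[unfolded cube_def mem_Collect_eq, rule_format, of i] by linarith
  qed
  then show ?thesis by simp
qed

lemma rect_cube:
  assumes "u \<in> cube n" "v \<in> cube n"
  shows "rect u v \<subseteq> cube n"
proof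
  fix x assume x: "x \<in> rect u v"
  have "\<bar>x $ i\<bar> \<le> n" for i
    using x[unfolded rect_def mem_Collect_eq, rule_format, of i]
      assms[unfolded cube_def mem_Collect_eq, rule_format, of i] by linarith
  then show "x \<in> cube n" by (simp add: cube_def)
qed

text \<open>A coordinate shared by both corners is constant on the rectangle, so shortest paths
  between two points of a face stay in that face. The legs of the detour over the boundary are of
  this kind.\<close>

lemma rect_face:
  assumes "u \<in> cube n" "v \<in> cube n" "u $ i = v $ i" "\<bar>u $ i\<bar> = n"
  shows "rect u v \<subseteq> cube_boundary n"
proof
  fix x assume x: "x \<in> rect u v"
  have "x $ i = u $ i"
    using x[unfolded rect_def mem_Collect_eq, rule_format, of i] assms(3) by simp
  then have "\<bar>x $ i\<bar> = n" using assms(4) by simp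
  moreover have "x \<in> cube n" using x rect_cube[OF assms(1,2)] by blast
  ultimately show "x \<in> cube_boundary n"
    unfolding cube_boundary_def by blast
qed

section \<open>The detour along the highway and over the boundary\<close>

lemma rect_highway:
  assumes "n \<le> k" "k \<le> N"
  shows "rect (axis a k) (axis a N) \<subseteq> highway a n N"
proof
  fix x assume x: "x \<in> rect (axis a k) (axis a N)"
  have "x $ i = 0" if "i \<noteq> a" for i
    using x[unfolded rect_def mem_Collect_eq, rule_format, of i] that by (auto simp: axis_def)
  moreover have "k \<le> x $ a" "x $ a \<le> N"
    using x[unfolded rect_def mem_Collect_eq, rule_format, of a] assms by (auto simp: axis_def)
  ultimately show "x \<in> highway a n N"
    unfolding highway_def using assms
    by (intro image_eqI[of _ _ "x $ a"]) (auto simp: axis_def vec_eq_iff)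
qed

lemma axis_in_cube: "\<bar>k\<bar> \<le> n \<Longrightarrow> axis a k \<in> cube n"
  by (auto simp: axis_def cube_def)

lemma l1_dist_axis: "l1_dist (axis a k) (axis a l) = \<bar>k - l\<bar>"
proof -
  have "l1_dist (axis a k) (axis a l) = (\<Sum>i\<in>UNIV. if i = a then \<bar>k - l\<bar> else 0)"
    unfolding l1_dist_def by (rule sum.cong) (auto simp: axis_def)
  then show ?thesis by simp
qed

text \<open>This isolates the highway direction \<open>a\<close> and the direction \<open>b\<close>
  of the side face used by the detour; the other coordinates contribute one common sum.\<close>

lemma l1_dist_split:
  assumes "a \<noteq> b"
  shows "l1_dist u v = \<bar>u $ a - v $ a\<bar> + \<bar>u $ b - v $ b\<bar> + (\<Sum>i\<in>UNIV-{a,b}. \<bar>u $ i - v $ i\<bar>)"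
proof -
  have "UNIV = insert a (insert b (UNIV - {a, b}))" by auto
  then have "l1_dist u v = (\<Sum>i\<in>insert a (insert b (UNIV - {a, b})). \<bar>u $ i - v $ i\<bar>)"
    unfolding l1_dist_def by simp
  also have "\<dots> = \<bar>u $ a - v $ a\<bar> + \<bar>u $ b - v $ b\<bar> + (\<Sum>i\<in>UNIV-{a,b}. \<bar>u $ i - v $ i\<bar>)"
    using assms by simp
  finally show ?thesis .
qed

text \<open>The detour runs along the highway to its end and then over faces of the cube. The factor 5
  is attained from the origin to the centre of the opposite face: \<open>N\<close> steps on the highway,
  then \<open>N + 2 * N + N\<close> steps around the cube.\<close>

lemma reachable_boundary:
  fixes a :: "'d::finite" and \<alpha> :: real
  assumes "CARD('d) \<ge> 2" and n: "0 \<le> n" "n \<le> k" "k < N" and "0 \<le> \<alpha>"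
    and hw: "\<And>u v. u \<in> highway a n N \<Longrightarrow> v \<in> highway a n N \<Longrightarrow> l1_dist u v = 1 \<Longrightarrow> \<omega> {u, v} \<le> \<alpha>"
    and bd: "\<And>u v. u \<in> cube_boundary N \<Longrightarrow> v \<in> cube_boundary N \<Longrightarrow> l1_dist u v = 1 \<Longrightarrow> \<omega> {u, v} \<le> \<alpha>"
    and y: "y \<in> cube_boundary N"
  shows "reachable \<omega> (axis a k) y (5 * \<alpha> * l1_dist (axis a k) y)"
proof -
  have yc: "y \<in> cube N" using y by (simp add: cube_boundary_def)
  then have yb: "\<bar>y $ i\<bar> \<le> N" for i by (simp add: cube_def)
  have r0: "reachable \<omega> (axis a k) (axis a N) (\<alpha> * l1_dist (axis a k) (axis a N))"
    using rect_highway[of n k N a] n by (intro reachable_rect hw) auto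
  have face: "reachable \<omega> u v (\<alpha> * l1_dist u v)"
    if "u \<in> cube N" "v \<in> cube N" "u $ i = v $ i" "\<bar>u $ i\<bar> = N" for u v i
    using rect_face[OF that] by (intro reachable_rect bd) auto
  have Nc: "axis a N \<in> cube N"
    using n by (simp add: axis_in_cube)
  have "\<exists>b. b \<noteq> a"
  proof (rule ccontr)
    assume "\<not> (\<exists>b. b \<noteq> a)"
    then have "(UNIV :: 'd set) = {a}" by auto
    then have "CARD('d) = 1" by (metis card_1_singleton_iff One_nat_def)
    with assms(1) show False by simp
  qed
  then obtain b0 where b0: "b0 \<noteq> a" by blast
  show ?thesis
  proof (cases "y $ a = N")
    \<comment> \<open>Here the detour is a shortest path: it continues from the highway within the
      face where the highway ends.\<close>
    case True
    have "reachable \<omega> (axis a N) y (\<alpha> * l1_dist (axis a N) y)"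
      using n True Nc yc by (intro face[where i = a]) auto
    with r0 have r: "reachable \<omega> (axis a k) y (\<alpha> * l1_dist (axis a k) (axis a N) + \<alpha> * l1_dist (axis a N) y)"
      by (rule reachable_trans)
    have ab: "a \<noteq> b0" using b0 by simp
    have "l1_dist (axis a k) y = N - k + l1_dist (axis a N) y"
      unfolding l1_dist_split[OF ab] using n True ab by (auto simp: axis_def intro!: sum.cong)
    then have "l1_dist (axis a k) (axis a N) + l1_dist (axis a N) y \<le> 5 * l1_dist (axis a k) y"
      using n l1_dist_nonneg[of "axis a N" y] by (simp add: l1_dist_axis)
    then have "\<alpha> * real_of_int (l1_dist (axis a k) (axis a N) + l1_dist (axis a N) y)
        \<le> \<alpha> * real_of_int (5 * l1_dist (axis a k) y)"
      using \<open>0 \<le> \<alpha>\<close> by (intro mult_left_mono) linarith+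
    with r show ?thesis
      by (elim reachable_mono) (simp add: algebra_simps)
  next
    case False
    \<comment> \<open>\<open>b\<close> selects the side face to pass over. If \<open>y\<close> is
      off the face opposite to the end of the highway, it is a side face containing
      \<open>y\<close>; otherwise any direction other than \<open>a\<close> will do.\<close>
    obtain b where b: "b \<noteq> a" "y $ a = - N \<or> \<bar>y $ b\<bar> = N"
    proof (cases "y $ a = - N")
      case True
      with b0 that show ?thesis by blast
    next
      case neq: False
      obtain i where "\<bar>y $ i\<bar> = N" using y by (auto simp: cube_boundary_def)
      with neq False that[of i] n show ?thesis by (metis abs_eq_iff abs_of_nonneg abs_if)
    qed
    \<comment> \<open>\<open>z\<close> is \<open>y\<close> pushed to the nearer side face in
      direction \<open>b\<close>, and \<open>z'\<close> is \<open>z\<close> moved to the end face of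
      the highway. The path through \<open>axis a N\<close>, \<open>z'\<close>, \<open>z\<close>,
      \<open>y\<close> then has one leg in each of the end face, the side face and the opposite
      face.\<close>
    define \<sigma> where "\<sigma> = (if y $ b \<ge> 0 then N else - N)"
    define z where "z = (\<chi> i. if i = b then \<sigma> else y $ i)"
    define z' where "z' = (\<chi> i. if i = a then N else z $ i)"
    have zc: "z \<in> cube N" "z' \<in> cube N"
      using n yb by (auto simp: cube_def z_def z'_def \<sigma>_def)
    have r1: "reachable \<omega> (axis a N) z' (\<alpha> * l1_dist (axis a N) z')"
      using n zc Nc by (intro face[where i = a]) (auto simp: z'_def)
    have r2: "reachable \<omega> z' z (\<alpha> * l1_dist z' z)"
      using n zc b(1) by (intro face[where i = b]) (auto simp: z'_def z_def \<sigma>_def)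
    have r3: "reachable \<omega> z y (\<alpha> * l1_dist z y)"
    proof (cases "y $ a = - N")
      case True
      then show ?thesis
        using n zc yc b(1) by (intro face[where i = a]) (auto simp: z_def)
    next
      \<comment> \<open>Off the opposite face, \<open>y\<close> already lies in the side face and
        the last leg is empty.\<close>
      case False
      then have "z $ i = y $ i" for i
        using b(2) n by (auto simp: z_def \<sigma>_def)
      then have "z = y" by (simp add: vec_eq_iff)
      then show ?thesis
        using reachable_refl[of \<omega> y] l1_dist_eq_0_iff[of y y] by simp
    qed
    let ?L = "l1_dist (axis a k) (axis a N) + l1_dist (axis a N) z' + l1_dist z' z + l1_dist z y"
    have r: "reachable \<omega> (axis a k) y (\<alpha> * l1_dist (axis a k) (axis a N) + \<alpha> * l1_dist (axis a N) z'
        + \<alpha> * l1_dist z' z + \<alpha> * l1_dist z y)"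
      by (intro reachable_trans[OF reachable_trans[OF reachable_trans[OF r0 r1] r2] r3])
    define R where "R = (\<Sum>i\<in>UNIV-{a,b}. \<bar>y $ i\<bar>)"
    have "R \<ge> 0" by (simp add: R_def sum_nonneg)
    have ab: "a \<noteq> b" using b by simp
    have e1: "l1_dist (axis a N) z' = N + R"
      unfolding l1_dist_split[OF ab] R_def using b n by (auto simp: axis_def z'_def z_def \<sigma>_def intro!: sum.cong)
    have e2: "l1_dist z' z = N - y $ a"
      unfolding l1_dist_split[OF ab] using b n yb[of a] by (auto simp: z'_def z_def)
    have e3: "l1_dist z y = N - \<bar>y $ b\<bar>"
      unfolding l1_dist_split[OF ab] using b n yb[of b] by (auto simp: z_def \<sigma>_def)
    have e4: "l1_dist (axis a k) y = \<bar>k - y $ a\<bar> + \<bar>y $ b\<bar> + R"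
      unfolding l1_dist_split[OF ab] R_def using b by (auto simp: axis_def intro!: sum.cong)
    have e0: "l1_dist (axis a k) (axis a N) = N - k"
      using n by (simp add: l1_dist_axis)
    have ya: "- N \<le> y $ a" using yb[of a] by linarith
    \<comment> \<open>The detour has length at most \<open>5 * N + R\<close> if \<open>y\<close> is
      on the opposite face and at most \<open>4 * N + R\<close> otherwise, while the distance to
      \<open>y\<close> is at least \<open>N + R\<close> in both cases.\<close>
    have "?L \<le> 5 * l1_dist (axis a k) y"
      unfolding e0 e1 e2 e3 e4 using b(2)
    proof
      assume "y $ a = - N"
      moreover have "\<bar>k + N\<bar> = k + N" using n by simp
      ultimately show "N - k + (N + R) + (N - y $ a) + (N - \<bar>y $ b\<bar>)
          \<le> 5 * (\<bar>k - y $ a\<bar> + \<bar>y $ b\<bar> + R)"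
        using n \<open>R \<ge> 0\<close> by simp
    next
      assume yN: "\<bar>y $ b\<bar> = N"
      have "N - k + (N + R) + (N - y $ a) \<le> 5 * (N + R)"
        using n \<open>R \<ge> 0\<close> ya by simp
      also have "\<dots> \<le> 5 * (\<bar>k - y $ a\<bar> + N + R)" by simp
      finally show "N - k + (N + R) + (N - y $ a) + (N - \<bar>y $ b\<bar>)
          \<le> 5 * (\<bar>k - y $ a\<bar> + \<bar>y $ b\<bar> + R)"
        unfolding yN by simp
    qed
    then have "\<alpha> * real_of_int ?L \<le> \<alpha> * real_of_int (5 * l1_dist (axis a k) y)"
      using \<open>0 \<le> \<alpha>\<close> by (intro mult_left_mono) linarith+
    with r show ?thesis
      by (elim reachable_mono) (simp add: algebra_simps)
  qed
qed

section \<open>The trap and the geodesic rays starting in it\<close>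

text \<open>The inner cube takes precedence, as its values may be forced by a given open set.
  Outside it, an edge that merely touches the highway or the boundary is slow. Strict bounds make
  every case an open half-line.\<close>

definition trap_values :: "'d::finite \<Rightarrow> int \<Rightarrow> int \<Rightarrow> real \<Rightarrow> real \<Rightarrow> real \<Rightarrow> (int ^ 'd) set \<Rightarrow> real set" where
  "trap_values a n N M \<alpha> \<beta> e =
     (if e \<subseteq> cube n then {..<M}
      else if e \<subseteq> highway a n N \<or> e \<subseteq> cube_boundary N then {..<\<alpha>}
      else {\<beta><..})"

text \<open>Edges not contained in \<open>cube N\<close> stay free, so only finitely many
  coordinates are constrained.\<close>

definition trapping :: "'d::finite \<Rightarrow> int \<Rightarrow> int \<Rightarrow> real \<Rightarrow> real \<Rightarrow> real \<Rightarrow> ((int ^ 'd) set \<Rightarrow> real) \<Rightarrow> bool" where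
  "trapping a n N M \<alpha> \<beta> \<omega> \<longleftrightarrow>
     (\<forall>e\<in>lattice_edges. e \<subseteq> cube N \<longrightarrow> \<omega> e \<in> trap_values a n N M \<alpha> \<beta> e)"

lemma open_trap_values: "open (trap_values a n N M \<alpha> \<beta> e)"
  by (auto simp: trap_values_def)

lemma highway_cube: "0 \<le> n \<Longrightarrow> highway a n N \<subseteq> cube N"
  by (auto simp: highway_def intro: axis_in_cube)

text \<open>An injective sequence must leave the finite \<open>cube (N - 1)\<close>. A step changes
  each coordinate by at most 1, so the first vertex outside lies on the boundary of
  \<open>cube N\<close>.\<close>

lemma ray_hits_boundary:
  fixes \<gamma> :: "nat \<Rightarrow> int ^ 'd::finite"
  assumes "inj \<gamma>" "\<And>j. l1_dist (\<gamma> j) (\<gamma> (Suc j)) = 1" "\<gamma> 0 \<in> cube n" "n < N"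
  obtains t where "\<gamma> t \<in> cube_boundary N" "\<And>j. j < t \<Longrightarrow> \<gamma> j \<in> cube (N - 1)"
proof -
  have "\<exists>j. \<gamma> j \<notin> cube (N - 1)"
  proof (rule ccontr)
    assume "\<not> ?thesis"
    then have "range \<gamma> \<subseteq> cube (N - 1)" by auto
    then have "finite (range \<gamma>)" using finite_cube finite_subset by blast
    with assms(1) show False using finite_imageD by blast
  qed
  then obtain t where "\<gamma> t \<notin> cube (N - 1)" "\<forall>j<t. \<not> \<gamma> j \<notin> cube (N - 1)"
    using exists_least_iff[of "\<lambda>j. \<gamma> j \<notin> cube (N - 1)"] by blast
  then have t: "\<gamma> t \<notin> cube (N - 1)" "\<And>j. j < t \<Longrightarrow> \<gamma> j \<in> cube (N - 1)"
    by auto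
  have "t \<noteq> 0"
    using t(1) assms(3) cube_mono[of n "N - 1"] assms(4) by (intro notI) auto
  then obtain s where s: "t = Suc s" using not0_implies_Suc by blast
  then have c: "\<gamma> s \<in> cube (N - 1)" using t by simp
  have le: "\<bar>\<gamma> t $ i\<bar> \<le> N" for i
    using c[unfolded cube_def mem_Collect_eq, rule_format, of i] assms(2)[of s]
      component_le_l1_dist[of "\<gamma> s" i "\<gamma> t"] s by auto
  obtain i where "\<not> \<bar>\<gamma> t $ i\<bar> \<le> N - 1"
    using t(1) by (auto simp: cube_def)
  with le[of i] have "\<bar>\<gamma> t $ i\<bar> = N" by linarith
  with le have "\<gamma> t \<in> cube_boundary N"
    by (auto simp: cube_boundary_def cube_def)
  with t that show ?thesis by blast
qed

lemma l1_dist_walk: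
  assumes "\<And>j. l1_dist (\<gamma> j) (\<gamma> (Suc j)) = 1" "s \<le> t"
  shows "l1_dist (\<gamma> s) (\<gamma> t) \<le> int (t - s)"
  using assms(2)
proof (induction rule: dec_induct)
  case base
  then show ?case using l1_dist_eq_0_iff[of "\<gamma> s" "\<gamma> s"] by simp
next
  case (step k)
  then show ?case
    using l1_dist_triangle[of "\<gamma> s" "\<gamma> (Suc k)" "\<gamma> k"] assms(1)[of k] by simp
qed

text \<open>After its last visit to the cube of size \<open>n\<close> or to the highway, a ray avoiding the last edge
  of the highway would reach the outer boundary over slow edges only; the detour is faster.\<close>

lemma geodesic_ray_trapped:
  fixes a :: "'d::finite"
  assumes "CARD('d) \<ge> 2" and n: "0 \<le> n" "n < N"
    and nonneg: "\<And>e. e \<in> lattice_edges \<Longrightarrow> 0 \<le> \<omega> e"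
    and trap: "trapping a n N M \<alpha> \<beta> \<omega>" and \<alpha>\<beta>: "0 \<le> \<alpha>" "5 * \<alpha> < \<beta>" and "0 \<le> M"
    and large: "2 * real CARD('d) * n * (M + 5 * \<alpha>) \<le> (\<beta> - 5 * \<alpha>) * (N - n)"
    and ray: "geodesic_ray \<omega> \<gamma>" and start: "\<gamma> 0 \<in> cube n"
  shows "{axis a (N - 1), axis a N} \<in> ray_edges \<gamma>"
proof (rule ccontr)
  assume avoid: "\<not> ?thesis"
  have step: "l1_dist (\<gamma> j) (\<gamma> (Suc j)) = 1" for j
    using ray by (simp add: geodesic_ray_def edge_iff)
  obtain t where t: "\<gamma> t \<in> cube_boundary N" "\<And>j. j < t \<Longrightarrow> \<gamma> j \<in> cube (N - 1)"
    using ray_hits_boundary[of \<gamma> n N] ray step start n by (auto simp: geodesic_ray_def)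
  have not_bd: "x \<notin> cube_boundary N" if "x \<in> cube m" "m < N" for x :: "int ^ 'd" and m
    using that unfolding cube_def cube_boundary_def by (auto dest: spec leD)
  have in_cube: "\<gamma> j \<in> cube N" if "j \<le> t" for j
    using that t cube_mono[of "N - 1" N] by (cases "j = t") (auto simp: cube_boundary_def)
  let ?W = "cube n \<union> highway a n N"
  have t0: "0 < t"
    using not_bd[OF start n(2)] t(1) by (metis gr0I)
  \<comment> \<open>Time \<open>t\<close> itself is excluded, since \<open>\<gamma> t\<close> may be
    the end of the highway.\<close>
  define s where "s = Max {j. j < t \<and> \<gamma> j \<in> ?W}"
  have fin: "finite {j. j < t \<and> \<gamma> j \<in> ?W}" by simp
  have "s \<in> {j. j < t \<and> \<gamma> j \<in> ?W}"
    unfolding s_def using t0 start by (intro Max_in fin) auto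
  then have s: "s < t" "\<gamma> s \<in> ?W" by auto
  have last: "\<gamma> j \<notin> ?W" if "s < j" "j < t" for j
    using Max_ge[OF fin, of j] that unfolding s_def[symmetric] by auto
  have slow: "\<beta> < \<omega> {\<gamma> j, \<gamma> (Suc j)}" if j: "s \<le> j" "j < t" for j
  proof -
    have 1: "\<not> {\<gamma> j, \<gamma> (Suc j)} \<subseteq> cube n"
      using last[of "Suc j"] j not_bd[of "\<gamma> t" n] n t(1) by (cases "Suc j = t") auto
    have 2: "\<not> {\<gamma> j, \<gamma> (Suc j)} \<subseteq> cube_boundary N"
      using not_bd[of "\<gamma> j" "N - 1"] t(2)[of j] j by auto
    \<comment> \<open>After time \<open>s\<close> a highway vertex can only occur at time
      \<open>t\<close>, and the only highway vertex on the boundary is \<open>axis a N\<close>; such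
      an edge would be the avoided one.\<close>
    have 3: "\<not> {\<gamma> j, \<gamma> (Suc j)} \<subseteq> highway a n N"
    proof
      assume sub: "{\<gamma> j, \<gamma> (Suc j)} \<subseteq> highway a n N"
      then have "Suc j = t" using last[of "Suc j"] j by (cases "Suc j = t") auto
      obtain p q where pq: "\<gamma> j = axis a p" "\<gamma> (Suc j) = axis a q" "p \<in> {n..N}" "q \<in> {n..N}"
        using sub by (auto simp: highway_def)
      have "axis a q \<in> cube_boundary N"
        using t(1) pq \<open>Suc j = t\<close> by simp
      moreover have "axis a q \<in> cube q"
        using pq n by (intro axis_in_cube) auto
      ultimately have "\<not> q < N" using not_bd by blast
      then have "q = N" using pq by simp
      moreover have "\<bar>p - q\<bar> = 1"
        using step[of j] pq by (simp add: l1_dist_axis)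
      ultimately have "p = N - 1" using pq by auto
      then have "{axis a (N - 1), axis a N} = {\<gamma> j, \<gamma> (Suc j)}"
        using pq \<open>q = N\<close> by simp
      with avoid show False by (auto simp: ray_edges_def)
    qed
    have "{\<gamma> j, \<gamma> (Suc j)} \<in> lattice_edges" "{\<gamma> j, \<gamma> (Suc j)} \<subseteq> cube N"
      using step[of j] in_cube[of j] in_cube[of "Suc j"] j by (auto simp: edge_iff)
    then have "\<omega> {\<gamma> j, \<gamma> (Suc j)} \<in> trap_values a n N M \<alpha> \<beta> {\<gamma> j, \<gamma> (Suc j)}"
      using trap unfolding trapping_def by blast
    with 1 2 3 show ?thesis unfolding trap_values_def by (simp only: if_False) simp
  qed
  have "real_of_int (l1_dist (\<gamma> s) (\<gamma> t)) \<le> real (t - s)"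
    using l1_dist_walk[of \<gamma> s t, OF step less_imp_le[OF s(1)]] by linarith
  then have "\<beta> * l1_dist (\<gamma> s) (\<gamma> t) \<le> \<beta> * real (t - s)"
    using \<alpha>\<beta> by (intro mult_left_mono) auto
  also have "\<dots> = (\<Sum>j=s..<t. \<beta>)"
    by simp
  also have "\<dots> < (\<Sum>j=s..<t. \<omega> {\<gamma> j, \<gamma> (Suc j)})"
    using s(1) slow by (intro sum_strict_mono) auto
  also have "\<dots> = path_time \<omega> (map \<gamma> [s..<Suc t])"
    by (rule path_time_map[symmetric]) (use s(1) in simp)
  finally have lower: "\<beta> * l1_dist (\<gamma> s) (\<gamma> t) < path_time \<omega> (map \<gamma> [s..<Suc t])" .
  have geo: "geodesic \<omega> (\<gamma> s) (\<gamma> t) (map \<gamma> [s..<Suc t])"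
    using ray s unfolding geodesic_ray_def by (meson less_imp_le)
  have no_reach: "\<not> reachable \<omega> (\<gamma> s) (\<gamma> t) (\<beta> * l1_dist (\<gamma> s) (\<gamma> t))"
    using geodesic_time_le[OF nonneg geo] lower by fastforce
  have fast: "\<omega> {u, v} \<le> \<alpha>"
    if uv: "l1_dist u v = 1" "{u, v} \<subseteq> highway a n N \<or> {u, v} \<subseteq> cube_boundary N" for u v
  proof -
    \<comment> \<open>The bound \<open>\<alpha>\<close> could fail only inside the inner cube, which
      shares with the highway just the vertex \<open>axis a n\<close> and does not meet the
      boundary.\<close>
    have "\<not> {u, v} \<subseteq> cube n"
    proof
      assume c: "{u, v} \<subseteq> cube n"
      then have hw: "{u, v} \<subseteq> highway a n N" using uv(2) not_bd[of u n] n by auto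
      have "x = axis a n" if "x \<in> cube n" "x \<in> highway a n N" for x
      proof -
        obtain p where p: "x = axis a p" "p \<in> {n..N}" using \<open>x \<in> highway a n N\<close> by (auto simp: highway_def)
        have "\<bar>x $ a\<bar> \<le> n" using \<open>x \<in> cube n\<close> by (simp add: cube_def)
        with p n have "p = n" by (simp add: axis_def)
        with p show ?thesis by simp
      qed
      then have "u = v" using c hw by auto
      with uv(1) l1_dist_eq_0_iff[of u v] show False by simp
    qed
    moreover have "{u, v} \<subseteq> cube N"
      using uv(2) highway_cube[of n a N] n by (auto simp: cube_boundary_def)
    then have "\<omega> {u, v} \<in> trap_values a n N M \<alpha> \<beta> {u, v}"
      using trap uv(1) unfolding trapping_def edge_iff[symmetric] by blast
    ultimately show ?thesis
      using uv(2) by (simp add: trap_values_def split: if_splits)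
  qed
  have detour: "reachable \<omega> (axis a k) (\<gamma> t) (5 * \<alpha> * l1_dist (axis a k) (\<gamma> t))"
    if "n \<le> k" "k < N" for k
    using that n t(1) assms(1) \<alpha>\<beta> fast by (intro reachable_boundary[where n = n and N = N]) auto
  show False
  proof (cases "\<gamma> s \<in> cube n")
    case False
    then obtain k where k: "\<gamma> s = axis a k" "n \<le> k" "k \<le> N"
      using s by (auto simp: highway_def)
    have "k \<noteq> N"
    proof
      assume "k = N"
      then have "\<bar>\<gamma> s $ a\<bar> = N" using k n by simp
      with t(2)[OF s(1)] show False by (auto simp: cube_def)
    qed
    then have "reachable \<omega> (\<gamma> s) (\<gamma> t) (5 * \<alpha> * l1_dist (\<gamma> s) (\<gamma> t))"
      using detour[of k] k by simp
    moreover have "5 * \<alpha> * l1_dist (\<gamma> s) (\<gamma> t) \<le> \<beta> * l1_dist (\<gamma> s) (\<gamma> t)"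
      using \<alpha>\<beta> l1_dist_nonneg by (intro mult_right_mono) auto
    ultimately show False using no_reach reachable_mono by blast
  next
    case True
    let ?x = "axis a n" and ?D = "real_of_int (l1_dist (\<gamma> s) (\<gamma> t))"
    have xc: "?x \<in> cube n" using n by (simp add: axis_in_cube)
    have "reachable \<omega> (\<gamma> s) ?x (M * l1_dist (\<gamma> s) ?x)"
    proof (rule reachable_rect)
      fix u v assume "u \<in> rect (\<gamma> s) ?x" "v \<in> rect (\<gamma> s) ?x" and uv: "l1_dist u v = 1"
      then have c: "{u, v} \<subseteq> cube n" using rect_cube[OF True xc] by blast
      then have "{u, v} \<subseteq> cube N" using cube_mono[of n N] n by auto
      then have "\<omega> {u, v} \<in> trap_values a n N M \<alpha> \<beta> {u, v}"
        using trap uv unfolding trapping_def edge_iff[symmetric] by blast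
      with c show "\<omega> {u, v} \<le> M" by (simp add: trap_values_def)
    qed
    then have r: "reachable \<omega> (\<gamma> s) (\<gamma> t) (M * l1_dist (\<gamma> s) ?x + 5 * \<alpha> * l1_dist ?x (\<gamma> t))"
      using detour[of n] n reachable_trans by blast
    \<comment> \<open>\<open>K\<close> bounds the l1 diameter of the inner cube. It enters twice: as
      the length of the crossing to \<open>axis a n\<close>, at cost \<open>M\<close> per edge, and
      as the error in replacing the distance from \<open>axis a n\<close> by that from
      \<open>\<gamma> s\<close>. The hypothesis \<open>large\<close> pays for both because
      \<open>?D\<close> is at least \<open>N - n\<close>.\<close>
    define K where "K = 2 * real CARD('d) * n"
    have Kb: "real_of_int (l1_dist (\<gamma> s) ?x) \<le> K"
    proof -
      have "real_of_int (l1_dist (\<gamma> s) ?x) \<le> real_of_int (2 * int CARD('d) * n)"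
        using l1_dist_cube[OF True xc] by linarith
      then show ?thesis by (simp add: K_def)
    qed
    have D2: "real_of_int (l1_dist ?x (\<gamma> t)) \<le> K + ?D"
      using Kb l1_dist_triangle[of ?x "\<gamma> t" "\<gamma> s"] l1_dist_commute[of ?x "\<gamma> s"] by linarith
    have D3: "real_of_int (N - n) \<le> ?D"
    proof -
      obtain i where i: "\<bar>\<gamma> t $ i\<bar> = N" using t(1) by (auto simp: cube_boundary_def)
      have "\<bar>\<gamma> s $ i\<bar> \<le> n" using True by (simp add: cube_def)
      with i component_le_l1_dist[of "\<gamma> s" i "\<gamma> t"] show ?thesis by linarith
    qed
    have "M * l1_dist (\<gamma> s) ?x + 5 * \<alpha> * l1_dist ?x (\<gamma> t) \<le> M * K + 5 * \<alpha> * (K + ?D)"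
      using Kb D2 \<open>0 \<le> M\<close> \<alpha>\<beta> by (intro add_mono mult_left_mono) auto
    also have "\<dots> = K * (M + 5 * \<alpha>) + 5 * \<alpha> * ?D"
      by (simp add: algebra_simps)
    also have "\<dots> \<le> (\<beta> - 5 * \<alpha>) * (N - n) + 5 * \<alpha> * ?D"
      using large by (simp add: K_def)
    also have "\<dots> \<le> (\<beta> - 5 * \<alpha>) * ?D + 5 * \<alpha> * ?D"
      using D3 \<alpha>\<beta> by (intro add_mono mult_left_mono) auto
    also have "\<dots> = \<beta> * ?D"
      by (simp add: algebra_simps)
    finally show False using r no_reach reachable_mono by blast
  qed
qed

section \<open>Openness and density of traps in the configuration space\<close>

lemma topspace_config_space: "topspace (config_space A) = lattice_edges \<rightarrow>\<^sub>E A"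
  by (simp add: config_space_def)

lemma finite_edges_cube: "finite {e \<in> lattice_edges. e \<subseteq> (cube N :: (int ^ 'd::finite) set)}"
  by (rule finite_subset[of _ "Pow (cube N)"]) (auto simp: finite_cube)

lemma openin_trapping:
  "openin (config_space A) {\<omega> \<in> topspace (config_space A). trapping a n N M \<alpha> \<beta> \<omega>}"
proof -
  define X where "X e = (if e \<in> lattice_edges \<and> e \<subseteq> cube N then A \<inter> trap_values a n N M \<alpha> \<beta> e else A)" for e
  have "openin (config_space A) (PiE lattice_edges X)"
    unfolding config_space_def
  proof (rule product_topology_basis)
    show "openin (top_of_set A) (X e)" for e
      unfolding X_def by (auto intro: open_trap_values)
    show "finite {e. X e \<noteq> topspace (top_of_set A)}"
      by (rule finite_subset[OF _ finite_edges_cube[of N]]) (auto simp: X_def)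
  qed
  also have "PiE lattice_edges X = {\<omega> \<in> topspace (config_space A). trapping a n N M \<alpha> \<beta> \<omega>}"
    unfolding topspace_config_space
    by (auto simp: X_def trapping_def PiE_iff extensional_def split: if_splits)
  finally show ?thesis .
qed

text \<open>A point \<open>\<omega>0\<close> of \<open>V\<close> is kept on the inner cube, and
  every other edge is reset to \<open>\<alpha>0\<close> or \<open>\<beta>0\<close>. The result stays
  in \<open>V\<close> because a basic neighbourhood of \<open>\<omega>0\<close> leaves those edges
  free.\<close>

lemma trapping_dense:
  fixes a :: "'d::finite" and m :: int
  assumes "\<alpha>0 \<in> A" "\<alpha>0 < \<alpha>" "\<beta>0 \<in> A" "\<beta> < \<beta>0" "5 * \<alpha> < \<beta>"
    and V: "openin (config_space A) V" "V \<noteq> {}"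
  shows "\<exists>\<omega>\<in>V. \<exists>n N M. max 0 m \<le> n \<and> n < N \<and> 0 \<le> M \<and> trapping a n N M \<alpha> \<beta> \<omega> \<and>
    2 * real CARD('d) * n * (M + 5 * \<alpha>) \<le> (\<beta> - 5 * \<alpha>) * (N - n)"
proof -
  obtain \<omega>0 where "\<omega>0 \<in> V" using V(2) by blast
  then obtain U where U: "finite {e \<in> lattice_edges. U e \<noteq> topspace (top_of_set A)}"
      "\<omega>0 \<in> PiE lattice_edges U" "PiE lattice_edges U \<subseteq> V"
    using V(1) unfolding config_space_def openin_product_topology_alt by blast
  let ?F = "{e \<in> lattice_edges. U e \<noteq> topspace (top_of_set A)}"
  have fe: "finite e" if "e \<in> lattice_edges" for e :: "(int ^ 'd) set"
    using that by (elim edge_cases) auto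
  have "finite (\<Union>?F)"
    using U(1) fe by auto
  then obtain n where n: "max 0 m \<le> n" "\<Union>?F \<subseteq> cube n"
    using finite_subset_cube by blast
  \<comment> \<open>The summand 1 makes the bound strict; inserting 0 covers the case of no edges
    and gives \<open>0 \<le> M\<close>.\<close>
  define M where "M = 1 + Max (insert 0 (\<omega>0 ` {e \<in> lattice_edges. e \<subseteq> cube n}))"
  have fin: "finite (insert 0 (\<omega>0 ` {e \<in> lattice_edges. e \<subseteq> cube n}))"
    using finite_edges_cube by blast
  have M: "\<omega>0 e < M" if "e \<in> lattice_edges" "e \<subseteq> cube n" for e
    using Max_ge[OF fin, of "\<omega>0 e"] that unfolding M_def by auto
  have M0: "0 \<le> M"
    using Max_ge[OF fin, of 0] unfolding M_def by auto
  define C where "C = 2 * real CARD('d) * n * (M + 5 * \<alpha>)"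
  obtain k :: nat where k: "C / (\<beta> - 5 * \<alpha>) < real k"
    using reals_Archimedean2 by blast
  \<comment> \<open>The 1 ensures \<open>n < N\<close> even for \<open>k = 0\<close>.\<close>
  define N where "N = n + 1 + int k"
  have "C \<le> (\<beta> - 5 * \<alpha>) * k"
    using k assms(5) by (simp add: pos_divide_less_eq mult.commute)
  also have "\<dots> \<le> (\<beta> - 5 * \<alpha>) * (N - n)"
    using assms(5) by (intro mult_left_mono) (auto simp: N_def)
  finally have large: "C \<le> (\<beta> - 5 * \<alpha>) * (N - n)" .
  \<comment> \<open>Off the lattice edges \<open>\<omega>0\<close> supplies the value
    \<open>undefined\<close> that extensionality requires.\<close>
  define \<omega> where "\<omega> e = (if e \<notin> lattice_edges \<or> e \<subseteq> cube n then \<omega>0 e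
    else if e \<subseteq> highway a n N \<or> e \<subseteq> cube_boundary N then \<alpha>0 else \<beta>0)" for e
  have "\<omega> \<in> PiE lattice_edges U"
  proof (rule PiE_I)
    fix e :: "(int ^ 'd) set" assume e: "e \<in> lattice_edges"
    show "\<omega> e \<in> U e"
    proof (cases "e \<subseteq> cube n")
      case True
      then show ?thesis using U(2) e by (auto simp: \<omega>_def)
    next
      case False
      then have "U e = A" using n(2) e by auto
      with False e assms(1,3) show ?thesis by (auto simp: \<omega>_def)
    qed
  next
    fix e :: "(int ^ 'd) set" assume "e \<notin> lattice_edges"
    then show "\<omega> e = undefined" using U(2) by (auto simp: \<omega>_def)
  qed
  then have "\<omega> \<in> V" using U(3) by blast
  moreover have "trapping a n N M \<alpha> \<beta> \<omega>"
    using M assms(2,4) by (simp add: trapping_def trap_values_def \<omega>_def)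
  ultimately show ?thesis
    using n(1) M0 large unfolding C_def N_def by (intro bexI[of _ \<omega>] exI[of _ n] exI[of _ "n + 1 + int k"]) auto
qed

text \<open>The complement of a dense open set is closed with empty interior, and these countably
  many complements have the complement of the intersection as their union.\<close>

lemma residual_in_Inter_dense_open:
  fixes U :: "nat \<Rightarrow> 'a set"
  assumes "\<And>m. openin X (U m)" and "\<And>m V. openin X V \<Longrightarrow> V \<noteq> {} \<Longrightarrow> V \<inter> U m \<noteq> {}"
  shows "residual_in X (\<Inter>m. U m)"
proof -
  have "nowhere_dense_in X (topspace X - U m)" for m
  proof -
    have "closedin X (topspace X - U m)" using assms(1) by blast
    then have *: "X closure_of (topspace X - U m) = topspace X - U m"
      by (simp add: closure_of_eq)
    have "X interior_of (topspace X - U m) = {}"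
    proof (rule ccontr)
      assume "X interior_of (topspace X - U m) \<noteq> {}"
      then have "X interior_of (topspace X - U m) \<inter> U m \<noteq> {}"
        by (intro assms(2)) auto
      then show False using interior_of_subset[of X "topspace X - U m"] by blast
    qed
    then show ?thesis by (simp add: nowhere_dense_in_def *)
  qed
  then have "meager_in X (topspace X - (\<Inter>m. U m))"
    unfolding meager_in_def
    by (intro exI[of _ "range (\<lambda>m. topspace X - U m)"]) auto
  moreover have "(\<Inter>m. U m) \<subseteq> topspace X"
    using openin_subset[OF assms(1)] by blast
  ultimately show ?thesis by (simp add: residual_in_def)
qed

section \<open>Choice of the thresholds and conclusion\<close>

text \<open>Even an infinite supremum is represented by a single real element
  \<open>\<beta>0\<close>. The strict gaps next to \<open>\<alpha>0\<close> and
  \<open>\<beta>0\<close> put these values into the open half-lines of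
  \<open>trap_values\<close>.\<close>

lemma separating_values:
  assumes "A \<subseteq> {0..}" "(SUP a\<in>A. ereal a) > 5 * (INF a\<in>A. ereal a)"
  obtains \<alpha>0 \<beta>0 \<alpha> \<beta> where "\<alpha>0 \<in> A" "\<alpha>0 < \<alpha>" "\<beta>0 \<in> A" "\<beta> < \<beta>0" "5 * \<alpha> < \<beta>" "0 \<le> \<alpha>"
proof -
  obtain \<beta>0 where b: "\<beta>0 \<in> A" "5 * (INF a\<in>A. ereal a) < ereal \<beta>0"
    using assms(2) by (auto simp: less_SUP_iff)
  have "\<exists>\<alpha>0\<in>A. 5 * \<alpha>0 < \<beta>0"
  proof (rule ccontr)
    assume "\<not> ?thesis"
    then have "ereal (\<beta>0 / 5) \<le> (INF a\<in>A. ereal a)"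
      by (intro INF_greatest) (auto simp: not_less)
    then have "5 * ereal (\<beta>0 / 5) \<le> 5 * (INF a\<in>A. ereal a)"
      by (intro ereal_mult_left_mono) auto
    moreover have "5 * ereal (\<beta>0 / 5) = ereal \<beta>0"
      by (simp add: numeral_eq_ereal)
    ultimately show False using b(2) by simp
  qed
  then obtain \<alpha>0 where a: "\<alpha>0 \<in> A" "5 * \<alpha>0 < \<beta>0" by blast
  have "0 \<le> \<alpha>0" using a assms(1) by auto
  \<comment> \<open>Raising \<open>\<alpha>0\<close> and lowering \<open>\<beta>0\<close> by
    \<open>\<delta>\<close> uses up \<open>6 * \<delta>\<close> of the gap
    \<open>20 * \<delta>\<close>.\<close>
  define \<delta> where "\<delta> = (\<beta>0 - 5 * \<alpha>0) / 20"
  have "\<delta> > 0" using a by (simp add: \<delta>_def)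
  show ?thesis
    by (rule that[of \<alpha>0 "\<alpha>0 + \<delta>" \<beta>0 "\<beta>0 - \<delta>"])
      (use a b \<open>\<delta> > 0\<close> \<open>0 \<le> \<alpha>0\<close> in \<open>auto simp: \<delta>_def field_simps\<close>)
qed

theorem theorem1p2:
  fixes A :: "real set"
  assumes "CARD('d::finite) \<ge> 2"
    and "A \<subseteq> {0..}"
    and "\<exists>a\<in>A. \<exists>b\<in>A. a \<noteq> b"
    and "(SUP a\<in>A. ereal a) > 5 * (INF a\<in>A. ereal a)"
  shows "\<exists>R. residual_in (config_space A :: ((int ^ 'd) set \<Rightarrow> real) topology) R \<and>
           (\<forall>\<omega>\<in>R. \<not> (\<exists>\<gamma> \<delta>. geodesic_ray \<omega> \<gamma> \<and> geodesic_ray \<omega> \<delta> \<and> distinct_rays \<gamma> \<delta>))"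
proof -
  obtain \<alpha>0 \<beta>0 \<alpha> \<beta> where v: "\<alpha>0 \<in> A" "\<alpha>0 < \<alpha>" "\<beta>0 \<in> A" "\<beta> < \<beta>0" "5 * \<alpha> < \<beta>" "0 \<le> \<alpha>"
    by (rule separating_values[OF assms(2,4)])
  \<comment> \<open>Any direction will do; all traps use the same one.\<close>
  define a :: 'd where "a = undefined"
  let ?X = "config_space A :: ((int ^ 'd) set \<Rightarrow> real) topology"
  define good where "good m n N M \<longleftrightarrow> max 0 (int m) \<le> n \<and> n < N \<and> 0 \<le> M \<and>
    2 * real CARD('d) * n * (M + 5 * \<alpha>) \<le> (\<beta> - 5 * \<alpha>) * (N - n)" for m n N M
  \<comment> \<open>The parameters \<open>n\<close>, \<open>N\<close>, \<open>M\<close> depend on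
    the neighbourhood in which a trap is sought, so \<open>U m\<close> is the union over all
    admissible ones; only \<open>n \<ge> m\<close> is prescribed.\<close>
  define U where "U m = (\<Union>(n, N, M) \<in> {(n, N, M). good m n N M}.
    {\<omega> \<in> topspace ?X. trapping a n N M \<alpha> \<beta> \<omega>})" for m
  have "residual_in ?X (\<Inter>m. U m)"
  proof (rule residual_in_Inter_dense_open)
    show "openin ?X (U m)" for m
      unfolding U_def by (intro openin_Union) (auto intro: openin_trapping)
    show "V \<inter> U m \<noteq> {}" if V: "openin ?X V" "V \<noteq> {}" for m V
    proof -
      obtain \<omega> n N M where *: "\<omega> \<in> V" "trapping a n N M \<alpha> \<beta> \<omega>" "good m n N M"
        using trapping_dense[OF v(1-5) V, of "int m" a] unfolding good_def by blast
      moreover have "\<omega> \<in> topspace ?X" using *(1) V(1) openin_subset by blast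
      ultimately have "\<omega> \<in> U m" unfolding U_def by blast
      with *(1) show ?thesis by blast
    qed
  qed
  moreover have False
    if \<omega>: "\<omega> \<in> (\<Inter>m. U m)" and \<gamma>: "geodesic_ray \<omega> \<gamma>" and \<delta>: "geodesic_ray \<omega> \<delta>"
      and dist: "distinct_rays \<gamma> \<delta>" for \<omega> \<gamma> \<delta>
  proof -
    \<comment> \<open>One cube holds all shared edges and both starting points, so a trap around it
      applies to both rays.\<close>
    have "finite (\<Union>(ray_edges \<gamma> \<inter> ray_edges \<delta>) \<union> {\<gamma> 0, \<delta> 0})"
      using dist by (auto simp: distinct_rays_def ray_edges_def)
    then obtain m' where m': "0 \<le> m'" "\<Union>(ray_edges \<gamma> \<inter> ray_edges \<delta>) \<union> {\<gamma> 0, \<delta> 0} \<subseteq> cube m'"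
      using finite_subset_cube by blast
    have "\<omega> \<in> U (nat m')" using \<omega> by blast
    then obtain n N M where *: "good (nat m') n N M" "\<omega> \<in> topspace ?X" "trapping a n N M \<alpha> \<beta> \<omega>"
      unfolding U_def by blast
    have nonneg: "0 \<le> \<omega> e" if "e \<in> lattice_edges" for e
      using *(2) that assms(2) by (auto simp: topspace_config_space)
    have mn: "m' \<le> n" "n < N" "0 \<le> n" using *(1) m'(1) by (auto simp: good_def)
    then have sub: "\<Union>(ray_edges \<gamma> \<inter> ray_edges \<delta>) \<union> {\<gamma> 0, \<delta> 0} \<subseteq> cube n"
      using m' cube_mono[of m' n] by blast
    have "{axis a (N - 1), axis a N} \<in> ray_edges \<rho>"
      if "geodesic_ray \<omega> \<rho>" "\<rho> 0 \<in> cube n" for \<rho>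
      using *(1,3) mn(3) assms(1) v nonneg that unfolding good_def
      by (intro geodesic_ray_trapped[where n = n and N = N and M = M and \<alpha> = \<alpha> and \<beta> = \<beta> and \<omega> = \<omega>]) auto
    then have "{axis a (N - 1), axis a N} \<in> ray_edges \<gamma> \<inter> ray_edges \<delta>"
      using \<gamma> \<delta> sub by blast
    \<comment> \<open>The forced common edge would have to lie in \<open>cube n\<close>, but its
      endpoint \<open>axis a N\<close> has the coordinate \<open>N > n\<close>.\<close>
    then have "axis a N \<in> (cube n :: (int ^ 'd) set)" using sub by blast
    then have "\<bar>(axis a N :: int ^ 'd) $ a\<bar> \<le> n" unfolding cube_def by blast
    then show False using mn m' by simp
  qed
  ultimately show ?thesis by blast
qed

end
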